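(* The Hopfield network, written in the form $$\dot q = -\frac{\partial P}{\partial V}(V,I),\qquad V=\frac{\partial H}{\partial q}(q) = -\frac{\partial P}{\partial I}(V,I),$$ is a relaxation system (with state $x=q$, $e=V$, input $u=I$, Hamiltonian $H$ and dissipation potential $P$) if and only if the function $$P(V,I) = -\frac12 V^\top T V+\sum_{i=1}^n\frac{1}{R_iC_i}H_i^*(V_i)-V^\top I$$ satisfies the passivity condition, which can be written out as $$V^\top R^{-1}v \;\ge\; V^\top T V\qquad\text{for all } v,V \text{ related by } V_i=g_i(v_i),\ i=1,\dots,n.$$
   Context: Hopfield network: the equations are $C\dot v = TV-R^{-1}v+I$, with $v,V\in\mathbb{R}^n$ vectors of voltage potentials related by $V_i=g_i(v_i)$, $i=1,\dots,n$, where each $g_i$ is a function of sigmoid type with $g_i'(v_i)>0$. Here $C$ is the diagonal matrix of capacitances $C_i>0$, $R$ is the diagonal matrix of resistances $R_i>0$, $I\in\mathbb{R}^n$ is the vector of incoming currents at the nodes, and the $n\times n$ matrix $T$ is symmetric (and typically indefinite). Charge coordinates: put $q_i:=C_iv_i$ and $h_i(q_i):=g_i(q_i/C_i)$, so $h_i'(q_i)>0$. Let $H_i$ be a function (unique up to a constant) with $H_i'=h_i$, so $H_i''>0$. The total energy is $H(q):=\sum_{i=1}^n H_i(q_i)$, which has positive definite Hessian, and $V_i=g_i(v_i)=H_i'(q_i)$. Let $H_i^*(V_i)=\sup_{q_i}[q_iV_i-H_i(q_i)]$ be the Legendre-Fenchel transform of $H_i$; the inverse of $V_i=H_i'(q_i)$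 is $q_i=(H_i^* )'(V_i)$. With $P$ as in the claim, the Hopfield equations take the form displayed at the start of the claim. Port-Hamiltonian systems: systems with state $x\in\mathbb{R}^n$, inputs $u\in\mathbb{R}^m$ and outputs $y\in\mathbb{R}^m$ of the form $$-\dot x=-J(x)e-G(x)u+\frac{\partial P}{\partial e}(x,e,u),\qquad y=G^\top(x)e+M(x)u+\frac{\partial P}{\partial u}(x,e,u),\qquad e=\frac{\partial H}{\partial x}(x),$$ where $J(x)$ and $M(x)$ are skew-symmetric, $H$ is the Hamiltonian (total energy), and the dissipation potential $P:\mathbb{R}^n\times\mathbb{R}^n\times\mathbb{R}^m\to\mathbb{R}$ satisfies the passivity condition $$e^\top\frac{\partial P}{\partial e}(x,e,u)+u^\top\frac{\partial P}{\partial u}(x,e,u)\ge 0\qquad\text{for all }x,e,u.$$ Relaxation systems: port-Hamiltonian systems with zero skew-symmetric part (i.e. the composed skew-symmetric matrix formed by $J,G,M$ is zero), where moreover $P$ is independent of $x$ and $H$ has positive Hessian matrix. That is, they are systems $$\dot x=-\frac{\partial P}{\partial e}(e,u),\qquad e=\frac{\partial H}{\partial x}(x),\qquad \frac{\partial^2H}{\partial x^\top\partial x}(x)>0,\qquad y=\frac{\partial P}{\partial u}(e,u),$$ with $P$ satisfying the passivity condition.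
   Formalization: To match V = −∂P/∂I, the output is y = −∂P/∂I and passivity reads V·∂P/∂V − I·∂P/∂I ≥ 0, for V in the range of the g_i; with the plus sign of the general definition it contains −2VᵀI and always fails. *)

theory Defs
  imports "HOL-Analysis.Analysis"
begin

section \<open>Gradients, Hessians, Legendre-Fenchel transform\<close>

text \<open>Meaningful only where the function is differentiable; the definitions of system classes below
  require this explicitly.\<close>

definition grad :: "('a::real_inner \<Rightarrow> real) \<Rightarrow> 'a \<Rightarrow> 'a" where
  "grad f x = (THE D. GDERIV f x :> D)"

definition has_hessian :: "(real^'n \<Rightarrow> real) \<Rightarrow> real^'n^'n \<Rightarrow> real^'n \<Rightarrow> bool" where
  "has_hessian f A x \<longleftrightarrow>
     (\<forall>z. f differentiable (at z)) \<and> (grad f has_derivative (\<lambda>h. A *v h)) (at x)"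

definition positive_definite :: "real^'n^'n \<Rightarrow> bool" where
  "positive_definite A \<longleftrightarrow> transpose A = A \<and> (\<forall>h. h \<noteq> 0 \<longrightarrow> h \<bullet> (A *v h) > 0)"

definition skew_symmetric :: "real^'n^'n \<Rightarrow> bool" where
  "skew_symmetric A \<longleftrightarrow> transpose A = - A"

text \<open>A real-valued supremum, hence meaningful only where the set is bounded above. For \<open>f\<close> convex and
  differentiable this includes the range of \<open>f'\<close>, and the transform is only used there.\<close>

definition legendre_fenchel :: "(real \<Rightarrow> real) \<Rightarrow> real \<Rightarrow> real" where
  "legendre_fenchel f V = (SUP q. q * V - f q)"

definition diag :: "real^'n \<Rightarrow> real^'n^'n" where
  "diag c = (\<chi> i j. if i = j then c $ i else 0)"


section \<open>Port-Hamiltonian systems and relaxation systems\<close>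

text \<open>A state space system is given by its vector field \<open>f x u\<close> (so \<open>x' = f x u\<close>) and its output map
  \<open>y x u\<close>. The open set \<open>E\<close> consists of the effort vectors on which the dissipation potential is
  defined (\<open>E = UNIV\<close> if there is no restriction).

  The number \<open>\<sigma>\<close> is the sign with which the derivative of the potential with respect to the input
  enters the output. The standard convention is \<open>\<sigma> = 1\<close>, where the passivity condition is
  \<open>e \<bullet> \<partial>P/\<partial>e + u \<bullet> \<partial>P/\<partial>u \<ge> 0\<close>. The Hopfield network has output \<open>y = V = - \<partial>P/\<partial>I\<close>,
  that is \<open>\<sigma> = -1\<close>; with \<open>\<sigma> = 1\<close> the condition for its potential would contain the term
  \<open>- 2 (V \<bullet> I)\<close> and fail for suitable \<open>I\<close> whenever \<open>V \<noteq> 0\<close>. For either sign the term in the condition is \<open>u \<bullet> (\<sigma> \<partial>P/\<partial>u)\<close>, the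
  contribution of the potential to the supplied power \<open>u \<bullet> y\<close>; the condition then says that the
  Hamiltonian increases no faster than energy is supplied (lemma \<open>port_hamiltonian_passive\<close>).\<close>

definition passivity_condition ::
  "real \<Rightarrow> (real^'n) set \<Rightarrow> (real^'n \<Rightarrow> real^'m \<Rightarrow> real) \<Rightarrow> bool" where
  "passivity_condition \<sigma> E P \<longleftrightarrow>
     (\<forall>e\<in>E. \<forall>u. e \<bullet> grad (\<lambda>e'. P e' u) e + u \<bullet> (\<sigma> *\<^sub>R grad (\<lambda>u'. P e u') u) \<ge> 0)"

definition port_hamiltonian ::
  "real \<Rightarrow> (real^'n) set \<Rightarrow> (real^'n \<Rightarrow> real^'n^'n) \<Rightarrow> (real^'n \<Rightarrow> real^'m^'n) \<Rightarrow> (real^'n \<Rightarrow> real^'m^'m)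
   \<Rightarrow> (real^'n \<Rightarrow> real) \<Rightarrow> (real^'n \<Rightarrow> real^'n \<Rightarrow> real^'m \<Rightarrow> real)
   \<Rightarrow> (real^'n \<Rightarrow> real^'m \<Rightarrow> real^'n) \<Rightarrow> (real^'n \<Rightarrow> real^'m \<Rightarrow> real^'m) \<Rightarrow> bool" where
  "port_hamiltonian \<sigma> E J G M H P f y \<longleftrightarrow>
     open E \<and>
     (\<forall>x. skew_symmetric (J x) \<and> skew_symmetric (M x)) \<and>
     (\<forall>x. H differentiable (at x) \<and> grad H x \<in> E) \<and>
     (\<forall>x. \<forall>e\<in>E. \<forall>u. (\<lambda>(e', u'). P x e' u') differentiable (at (e, u))) \<and>
     (\<forall>x u. - f x u =
        - (J x *v grad H x) - G x *v u + grad (\<lambda>e'. P x e' u) (grad H x)) \<and>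
     (\<forall>x u. y x u =
        transpose (G x) *v grad H x + M x *v u + \<sigma> *\<^sub>R grad (\<lambda>u'. P x (grad H x) u') u) \<and>
     (\<forall>x. passivity_condition \<sigma> E (P x))"

definition relaxation_system ::
  "real \<Rightarrow> (real^'n) set \<Rightarrow> (real^'n \<Rightarrow> real) \<Rightarrow> (real^'n \<Rightarrow> real^'m \<Rightarrow> real)
   \<Rightarrow> (real^'n \<Rightarrow> real^'m \<Rightarrow> real^'n) \<Rightarrow> (real^'n \<Rightarrow> real^'m \<Rightarrow> real^'m) \<Rightarrow> bool" where
  "relaxation_system \<sigma> E H P f y \<longleftrightarrow>
     port_hamiltonian \<sigma> E (\<lambda>x. 0) (\<lambda>x. 0) (\<lambda>x. 0) H (\<lambda>x. P) f y \<and>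
     (\<forall>x. \<exists>A. has_hessian H A x \<and> positive_definite A)"

lemma port_hamiltonian_passive:
  assumes "port_hamiltonian \<sigma> E J G M H P f y"
  shows "grad H x \<bullet> f x u \<le> u \<bullet> y x u"
proof -
  have skew0: "v \<bullet> (A *v v) = 0" if "skew_symmetric A" for A :: "real^'k^'k" and v
  proof -
    have "v \<bullet> (A *v v) = (transpose A *v v) \<bullet> v"
      by (simp add: dot_lmul_matrix)
    also have "\<dots> = - (v \<bullet> (A *v v))"
      using that unfolding skew_symmetric_def
      by (simp add: matrix_vector_mult_def inner_vec_def sum_negf mult.commute)
    finally show ?thesis by simp
  qed
  let ?e = "grad H x"
  have J: "?e \<bullet> (J x *v ?e) = 0" and M: "u \<bullet> (M x *v u) = 0"
    using assms skew0 unfolding port_hamiltonian_def by blast+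
  have "- f x u = - (J x *v ?e) - G x *v u + grad (\<lambda>e'. P x e' u) ?e"
    using assms unfolding port_hamiltonian_def by blast
  then have f: "f x u = J x *v ?e + G x *v u - grad (\<lambda>e'. P x e' u) ?e"
    by (simp add: minus_equation_iff[of "f x u"] add.commute)
  have y: "y x u = transpose (G x) *v ?e + M x *v u + \<sigma> *\<^sub>R grad (\<lambda>u'. P x ?e u') u"
    using assms unfolding port_hamiltonian_def by blast
  have "?e \<bullet> grad (\<lambda>e'. P x e' u) ?e + u \<bullet> (\<sigma> *\<^sub>R grad (\<lambda>u'. P x ?e u') u) \<ge> 0"
    using assms unfolding port_hamiltonian_def passivity_condition_def by blast
  moreover have "u \<bullet> (transpose (G x) *v ?e) = ?e \<bullet> (G x *v u)"
    by (metis dot_lmul_matrix inner_commute transpose_matrix_vector)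
  ultimately show ?thesis
    unfolding f y inner_add_right inner_diff_right using J M by linarith
qed


section \<open>Hopfield networks\<close>

text \<open>The function need not be odd, and the number and position of its inflection points are left free.\<close>

definition sigmoid :: "(real \<Rightarrow> real) \<Rightarrow> bool" where
  "sigmoid g \<longleftrightarrow> bounded (range g) \<and> (\<forall>v. \<exists>d>0. (g has_real_derivative d) (at v))"

definition activation :: "('n \<Rightarrow> real \<Rightarrow> real) \<Rightarrow> real^'n \<Rightarrow> real^'n" where
  "activation g v = (\<chi> i. g i (v $ i))"

text \<open>The right-hand side of \<open>C v' = T V - R\<^sup>-\<^sup>1 v + I\<close>.\<close>

definition hopfield_rhs ::
  "real^'n \<Rightarrow> real^'n^'n \<Rightarrow> ('n \<Rightarrow> real \<Rightarrow> real) \<Rightarrow> real^'n \<Rightarrow> real^'n \<Rightarrow> real^'n" where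
  "hopfield_rhs R T g v I = T *v activation g v - matrix_inv (diag R) *v v + I"

text \<open>The network in charge coordinates \<open>q = C v\<close>, with output \<open>V\<close>.\<close>

definition hopfield_field ::
  "real^'n \<Rightarrow> real^'n \<Rightarrow> real^'n^'n \<Rightarrow> ('n \<Rightarrow> real \<Rightarrow> real) \<Rightarrow> real^'n \<Rightarrow> real^'n \<Rightarrow> real^'n" where
  "hopfield_field C R T g q I = hopfield_rhs R T g (matrix_inv (diag C) *v q) I"

definition hopfield_output ::
  "real^'n \<Rightarrow> ('n \<Rightarrow> real \<Rightarrow> real) \<Rightarrow> real^'n \<Rightarrow> real^'n \<Rightarrow> real^'n" where
  "hopfield_output C g q I = activation g (matrix_inv (diag C) *v q)"

definition hopfield_solution ::
  "real^'n \<Rightarrow> real^'n \<Rightarrow> real^'n^'n \<Rightarrow> ('n \<Rightarrow> real \<Rightarrow> real)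
   \<Rightarrow> real set \<Rightarrow> (real \<Rightarrow> real^'n) \<Rightarrow> (real \<Rightarrow> real^'n) \<Rightarrow> bool" where
  "hopfield_solution C R T g S v I \<longleftrightarrow>
     (\<forall>t\<in>S. \<exists>v'. (v has_vector_derivative v') (at t within S) \<and>
                 diag C *v v' = hopfield_rhs R T g (v t) (I t))"

definition hopfield_energy :: "('n::finite \<Rightarrow> real \<Rightarrow> real) \<Rightarrow> real^'n \<Rightarrow> real" where
  "hopfield_energy Hs q = (\<Sum>i\<in>UNIV. Hs i (q $ i))"

definition hopfield_potential ::
  "real^'n \<Rightarrow> real^'n \<Rightarrow> real^'n^'n \<Rightarrow> ('n \<Rightarrow> real \<Rightarrow> real) \<Rightarrow> real^'n \<Rightarrow> real^'n \<Rightarrow> real" where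
  "hopfield_potential C R T Hs V I =
     - (1/2) * (V \<bullet> (T *v V)) + (\<Sum>i\<in>UNIV. 1 / (R $ i * C $ i) * legendre_fenchel (Hs i) (V $ i))
     - V \<bullet> I"

definition hopfield_efforts :: "('n::finite \<Rightarrow> real \<Rightarrow> real) \<Rightarrow> (real^'n) set" where
  "hopfield_efforts g = {V. \<forall>i. V $ i \<in> range (g i)}"

end

theory Submission
  imports Defs
begin

text \<open>Everything rests on one gradient. The Legendre-Fenchel transform of \<open>H\<^sub>i\<close> inverts the
  derivative of \<open>H\<^sub>i\<close>: its derivative at \<open>V\<^sub>i = g\<^sub>i (v\<^sub>i)\<close> is the charge \<open>q\<^sub>i = C\<^sub>i v\<^sub>i\<close>
  (lemma \<open>legendre_fenchel_has_derivative\<close>). With the weights \<open>1 / (R\<^sub>i C\<^sub>i)\<close> and the symmetry of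
  \<open>T\<close> it follows that, at the effort \<open>V\<close> with potentials \<open>v\<close>, the gradient of \<open>P\<close> in \<open>V\<close> is
  \<open>- (T V - R\<^sup>-\<^sup>1 v + I)\<close> and the gradient in \<open>I\<close> is \<open>- V\<close> (lemma \<open>potential_has_derivative\<close>).

  The three claims can then be read off. The Hopfield equations are the gradient equations because
  \<open>q = C v\<close> with \<open>C\<close> invertible, and \<open>V\<close> is the gradient of the energy (lemma
  \<open>solution_iff\<close>). In the passivity condition the two terms in \<open>I\<close> cancel, leaving
  \<open>V \<bullet> R\<^sup>-\<^sup>1 v - V \<bullet> T V \<ge> 0\<close> (lemma \<open>passivity_iff\<close>). Among the requirements on a
  relaxation system, passivity is the only one that can fail: the others are the gradient
  equations, differentiability of \<open>P\<close> on the open box of attainable efforts, and positivity of the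
  diagonal Hessian of the energy, whose entries are \<open>g\<^sub>i' (v\<^sub>i) / C\<^sub>i\<close> (lemma
  \<open>relaxation_iff\<close>).\<close>

section \<open>Linear algebra and gradients\<close>

lemma diag_mult_vector: "diag c *v x = (\<chi> i. c $ i * x $ i)"
  by (simp add: diag_def matrix_vector_mult_def vec_eq_iff if_distrib[of "\<lambda>a. a * _"] cong: if_cong)

lemma matrix_inv_diag_mult_vector:
  fixes c x :: "real^'n"
  assumes "\<And>i. c $ i \<noteq> 0"
  shows "matrix_inv (diag c) *v x = (\<chi> i. x $ i / c $ i)"
proof -
  let ?D = "diag (\<chi> i. inverse (c $ i))"
  have "diag c ** ?D = mat 1" "?D ** diag c = mat 1"
    using assms by (auto simp: matrix_eq diag_mult_vector vec_eq_iff simp flip: matrix_vector_mul_assoc)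
  then have "matrix_inv (diag c) ** diag c = mat 1"
    unfolding matrix_inv_def by - (rule someI2[where a = ?D], auto)
  moreover have "x = diag c *v (\<chi> i. x $ i / c $ i)"
    using assms by (simp add: diag_mult_vector vec_eq_iff)
  ultimately show ?thesis
    by (metis matrix_vector_mul_assoc matrix_vector_mul_lid)
qed

lemma grad_eqI:
  assumes "(f has_derivative (\<lambda>h. h \<bullet> D)) (at x)"
  shows "grad f x = D"
  unfolding grad_def
proof (rule the_equality)
  show "GDERIV f x :> D"
    using assms by (simp add: gderiv_def)
  fix D'
  assume "GDERIV f x :> D'"
  then have "(\<lambda>h. h \<bullet> D') = (\<lambda>h. h \<bullet> D)"
    unfolding gderiv_def by (rule has_derivative_unique[OF _ assms])
  then show "D' = D"
    by (metis inner_commute vector_eq_rdot)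
qed

section \<open>The Legendre-Fenchel transform of a strictly convex function\<close>

lemma strict_mono_if_deriv_pos:
  fixes h :: "real \<Rightarrow> real"
  assumes "\<And>x. \<exists>d>0. (h has_real_derivative d) (at x)"
  shows "strict_mono h"
  by (rule strict_monoI) (metis DERIV_pos_imp_increasing assms)

lemma isCont_if_deriv_pos:
  fixes h :: "real \<Rightarrow> real"
  assumes "\<And>x. \<exists>d>0. (h has_real_derivative d) (at x)"
  shows "isCont h x"
  using assms DERIV_isCont by blast

lemma range_contains_neighbourhood:
  fixes h :: "real \<Rightarrow> real"
  assumes "\<And>x. \<exists>d>0. (h has_real_derivative d) (at x)"
  shows "{h (x - 1)<..<h (x + 1)} \<subseteq> range h"
proof
  fix y
  assume "y \<in> {h (x - 1)<..<h (x + 1)}"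
  then show "y \<in> range h"
    using IVT'[of h "x - 1" y "x + 1"] isCont_if_deriv_pos[OF assms]
    by (force intro: continuous_at_imp_continuous_on)
qed

lemma open_range_if_deriv_pos:
  fixes h :: "real \<Rightarrow> real"
  assumes "\<And>x. \<exists>d>0. (h has_real_derivative d) (at x)"
  shows "open (range h)"
proof (rule Topological_Spaces.openI)
  fix y
  assume "y \<in> range h"
  then obtain x where "y = h x" by blast
  moreover have "h (x - 1) < h x" "h x < h (x + 1)"
    using strict_mono_if_deriv_pos[OF assms] by (auto simp: strict_mono_less)
  ultimately show "\<exists>U. open U \<and> y \<in> U \<and> U \<subseteq> range h"
    using range_contains_neighbourhood[OF assms]
    by (intro exI[of _ "{h (x - 1)<..<h (x + 1)}"]) simp
qed

text \<open>A convex function lies above its tangent of slope \<open>h q\<close> at \<open>q\<close>, so this slope is the one at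
  which \<open>q\<close> maximizes \<open>p * h q - f p\<close>; in particular the supremum is a maximum.\<close>

lemma legendre_fenchel_at_slope:
  assumes deriv: "\<And>q. (f has_real_derivative h q) (at q)" and "mono h"
  shows "legendre_fenchel f (h q) = q * h q - f q"
proof -
  have "convex_on UNIV f"
    using deriv \<open>mono h\<close> by (intro convex_on_realI[where f' = h]) (auto simp: mono_def)
  then have "h q * (p - q) \<le> f p - f q" for p
    by (rule convex_on_imp_above_tangent) (use deriv in auto)
  then have "p * h q - f p \<le> q * h q - f q" for p
    by (smt (verit) mult.commute right_diff_distrib)
  then show ?thesis
    unfolding legendre_fenchel_def by (intro cSup_eq_maximum) auto
qed

text \<open>Along \<open>V = h q\<close> the transform is \<open>q * h q - f q\<close>, whose derivative \<open>q * h' q\<close> has lost the term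
  with \<open>h q\<close> since \<open>f' = h\<close>. Dividing by \<open>dV/dq = h' q\<close>, which is nonzero, leaves \<open>q\<close>.\<close>

lemma legendre_fenchel_has_derivative:
  assumes f: "\<And>q. (f has_real_derivative h q) (at q)"
    and h: "\<And>q. \<exists>d>0. (h has_real_derivative d) (at q)"
  shows "(legendre_fenchel f has_real_derivative q) (at (h q))"
proof -
  define k where "k = inv h"
  have sm: "strict_mono h" by (rule strict_mono_if_deriv_pos[OF h])
  have k: "k (h x) = x" for x
    unfolding k_def using sm by (simp add: strict_mono_imp_inj_on)
  have hk: "h (k y) = y" if "y \<in> range h" for y
    unfolding k_def using that by (rule f_inv_into_f)
  obtain d where "d > 0" and d: "(h has_real_derivative d) (at q)" using h by blast
  have lt: "h (q - 1) < h q" "h q < h (q + 1)"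
    using sm by (auto simp: strict_mono_less)
  \<comment> \<open>An interval around \<open>h q\<close> in the range, where \<open>k\<close> is a genuine inverse of \<open>h\<close>.\<close>
  have nbhd: "y \<in> range h" if "h (q - 1) < y" "y < h (q + 1)" for y
    using range_contains_neighbourhood[OF h, of q] that by auto
  have "isCont k (h q)"
    by (rule isCont_inverse_function[of 1]) (use k isCont_if_deriv_pos[OF h] in auto)
  then have dk: "(k has_real_derivative inverse d) (at (h q))"
    using lt d \<open>d > 0\<close> hk nbhd k
    by (intro DERIV_inverse_function[where f = h and a = "h (q - 1)" and b = "h (q + 1)"]) auto
  have "((\<lambda>x. x * h x - f x) has_real_derivative q * d) (at q)"
    using d f by (auto intro!: derivative_eq_intros)
  then have "((\<lambda>y. k y * h (k y) - f (k y)) has_real_derivative q * d * inverse d) (at (h q))"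
    using DERIV_chain2[where f = "\<lambda>x. x * h x - f x", OF _ dk] k by simp
  then have "((\<lambda>y. k y * h (k y) - f (k y)) has_real_derivative q) (at (h q))"
    using \<open>d > 0\<close> by (simp add: mult.assoc)
  then show ?thesis
  proof (rule has_field_derivative_transform_within_open[where S = "range h"])
    fix y assume "y \<in> range h"
    then show "k y * h (k y) - f (k y) = legendre_fenchel f y"
      using legendre_fenchel_at_slope[OF f strict_mono_mono[OF sm], of "k y"] hk by simp
  qed (use open_range_if_deriv_pos[OF h] in auto)
qed

section \<open>The Hopfield network\<close>

locale hopfield_network =
  fixes C R :: "real^'n" and T :: "real^'n^'n" and g Hs :: "'n \<Rightarrow> real \<Rightarrow> real"
  assumes C: "C $ i > 0" and R: "R $ i > 0" and T: "transpose T = T"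
    and g: "sigmoid (g i)"
    and Hs: "(Hs i has_real_derivative g i (q / C $ i)) (at q)"
begin

abbreviation "P \<equiv> hopfield_potential C R T Hs"

lemma g_deriv: "\<exists>d>0. (g i has_real_derivative d) (at x)"
  using g by (simp add: sigmoid_def)

lemma charge_activation_deriv:
  assumes "(g i has_real_derivative d) (at (q / C $ i))"
  shows "((\<lambda>q. g i (q / C $ i)) has_real_derivative d / C $ i) (at q)"
proof -
  have "((\<lambda>q. q / C $ i) has_real_derivative 1 / C $ i) (at q)"
    using C[of i] by (auto intro!: derivative_eq_intros)
  from DERIV_chain2[OF assms this] show ?thesis by simp
qed

lemma C_nonzero: "C $ i \<noteq> 0" and R_nonzero: "R $ i \<noteq> 0"
  using C R by (metis less_irrefl)+

lemma inv_C: "matrix_inv (diag C) *v x = (\<chi> i. x $ i / C $ i)"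
  by (rule matrix_inv_diag_mult_vector[OF C_nonzero])

lemma inv_R: "matrix_inv (diag R) *v x = (\<chi> i. x $ i / R $ i)"
  by (rule matrix_inv_diag_mult_vector[OF R_nonzero])

lemma C_inv_C: "diag C *v (matrix_inv (diag C) *v x) = x"
  by (simp add: inv_C diag_mult_vector vec_eq_iff C_nonzero)

lemma inv_C_C: "matrix_inv (diag C) *v (diag C *v x) = x"
  by (simp add: inv_C diag_mult_vector vec_eq_iff C_nonzero)

text \<open>Attainable efforts can be parametrized by the potentials \<open>v\<close>; this turns conditions on all
  efforts into conditions on all \<open>v\<close>, where every gradient has a closed form.\<close>

lemma efforts_eq: "hopfield_efforts g = range (activation g)"
proof (intro equalityI subsetI)
  fix V assume "V \<in> hopfield_efforts g"
  then have "\<forall>i. \<exists>x. V $ i = g i x"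
    by (auto simp: hopfield_efforts_def)
  then obtain x where "\<And>i. V $ i = g i (x i)" by metis
  then have "V = activation g (\<chi> i. x i)"
    by (simp add: activation_def vec_eq_iff)
  then show "V \<in> range (activation g)" by blast
qed (auto simp: hopfield_efforts_def activation_def)

lemma open_efforts: "open (hopfield_efforts g)"
  unfolding hopfield_efforts_def
  by (rule open_vector_box) (use open_range_if_deriv_pos[OF g_deriv] in auto)

lemma transform_has_derivative:
  "(legendre_fenchel (Hs i) has_real_derivative C $ i * x) (at (g i x))"
proof -
  have "\<exists>d>0. ((\<lambda>q. g i (q / C $ i)) has_real_derivative d) (at q)" for q
  proof -
    obtain d where "d > 0" "(g i has_real_derivative d) (at (q / C $ i))"
      using g_deriv by blast
    then show ?thesis
      using charge_activation_deriv[of i d q] C[of i] by (intro exI[of _ "d / C $ i"]) simp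
  qed
  with Hs have "(legendre_fenchel (Hs i) has_real_derivative C $ i * x) (at (g i (C $ i * x / C $ i)))"
    by (rule legendre_fenchel_has_derivative)
  then show ?thesis
    by (simp add: C_nonzero)
qed

text \<open>The weight \<open>1 / (R\<^sub>i C\<^sub>i)\<close> turns the charge \<open>C\<^sub>i v\<^sub>i\<close>, the derivative of the transform at
  \<open>g\<^sub>i (v\<^sub>i)\<close>, into the leakage current \<open>v\<^sub>i / R\<^sub>i\<close>; the symmetry of \<open>T\<close> makes \<open>- T V\<close> the
  gradient of the quadratic part. The derivative is taken jointly because a port-Hamiltonian system
  requires joint differentiability; the partial gradients follow by restriction.\<close>

lemma potential_has_derivative:
  "((\<lambda>(V, I). P V I) has_derivative
     (\<lambda>(k, l). k \<bullet> (- hopfield_rhs R T g v I) + l \<bullet> (- activation g v))) (at (activation g v, I))"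
proof -
  let ?V = "activation g v"
  have lin: "((*v) T has_derivative (*v) T) (at x)" for x
    by (rule bounded_linear_imp_has_derivative[OF matrix_vector_mul_bounded_linear])
  have dT: "((\<lambda>z. T *v fst z) has_derivative (\<lambda>z. T *v fst z)) (at (?V, I))"
    by (rule has_derivative_compose[OF _ lin]) (rule has_derivative_fst, rule has_derivative_ident)
  have dL: "((\<lambda>z. legendre_fenchel (Hs i) (fst z $ i)) has_derivative
      (\<lambda>z. C $ i * v $ i * fst z $ i)) (at (?V, I))" for i
  proof -
    have "((\<lambda>z. fst z $ i) has_derivative (\<lambda>z. fst z $ i)) (at (?V, I))"
      by (intro bounded_linear_imp_has_derivative bounded_linear_compose[OF bounded_linear_vec_nth]
          bounded_linear_fst)
    moreover have "(legendre_fenchel (Hs i) has_derivative (*) (C $ i * v $ i)) (at (fst (?V, I) $ i))"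
      using transform_has_derivative[of i "v $ i"]
      by (simp add: activation_def has_field_derivative_def)
    ultimately show ?thesis by (rule has_derivative_compose)
  qed
  have sym: "?V \<bullet> (T *v k) = k \<bullet> (T *v ?V)" for k
    by (metis T dot_lmul_matrix inner_commute transpose_matrix_vector)
  have leak: "(\<Sum>i\<in>UNIV. 1 / (R $ i * C $ i) * (C $ i * v $ i * k $ i)) = k \<bullet> (matrix_inv (diag R) *v v)"
    for k
    unfolding inner_vec_def inv_R
    by (intro sum.cong) (auto simp: field_simps C_nonzero R_nonzero)
  have "((\<lambda>z. - (1/2) * (fst z \<bullet> (T *v fst z))
        + (\<Sum>i\<in>UNIV. 1 / (R $ i * C $ i) * legendre_fenchel (Hs i) (fst z $ i)) - fst z \<bullet> snd z)
     has_derivative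
     (\<lambda>z. - (1/2) * (?V \<bullet> (T *v fst z) + fst z \<bullet> (T *v ?V))
        + (\<Sum>i\<in>UNIV. 1 / (R $ i * C $ i) * (C $ i * v $ i * fst z $ i))
        - (?V \<bullet> snd z + fst z \<bullet> I))) (at (?V, I))"
    by (rule derivative_eq_intros dT dL refl | simp)+
  then show ?thesis
    unfolding sym leak hopfield_potential_def case_prod_unfold
    by (simp add: hopfield_rhs_def inner_diff_right inner_add_right algebra_simps inner_commute)
qed

lemma grad_potential_effort:
  "grad (\<lambda>V. P V I) (activation g v) = - hopfield_rhs R T g v I"
proof (rule grad_eqI)
  have "((\<lambda>V. (V, I)) has_derivative (\<lambda>k. (k, 0))) (at (activation g v))"
    by (auto intro!: derivative_eq_intros)
  from has_derivative_compose[OF this potential_has_derivative]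
  show "((\<lambda>V. P V I) has_derivative (\<lambda>k. k \<bullet> - hopfield_rhs R T g v I)) (at (activation g v))"
    by simp
qed

lemma grad_potential_input:
  "grad (\<lambda>I. P (activation g v) I) I = - activation g v"
proof (rule grad_eqI)
  have "((\<lambda>I. (activation g v, I)) has_derivative (\<lambda>l. (0, l))) (at I)"
    by (auto intro!: derivative_eq_intros)
  from has_derivative_compose[OF this potential_has_derivative]
  show "((\<lambda>I. P (activation g v) I) has_derivative (\<lambda>l. l \<bullet> - activation g v)) (at I)"
    by simp
qed

lemma energy_has_derivative:
  "(hopfield_energy Hs has_derivative (\<lambda>k. k \<bullet> activation g (matrix_inv (diag C) *v q))) (at q)"
proof -
  have "((\<lambda>q. Hs i (q $ i)) has_derivative (\<lambda>k. g i (q $ i / C $ i) * k $ i)) (at q)" for i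
  proof -
    have "((\<lambda>q. q $ i) has_derivative (\<lambda>q. q $ i)) (at q)"
      by (rule bounded_linear_imp_has_derivative[OF bounded_linear_vec_nth])
    moreover have "(Hs i has_derivative (*) (g i (q $ i / C $ i))) (at (q $ i))"
      using Hs[of i "q $ i"] by (simp add: has_field_derivative_def)
    ultimately show ?thesis by (rule has_derivative_compose)
  qed
  then have "((\<lambda>q. \<Sum>i\<in>UNIV. Hs i (q $ i)) has_derivative
      (\<lambda>k. \<Sum>i\<in>UNIV. g i (q $ i / C $ i) * k $ i)) (at q)"
    by (intro has_derivative_sum)
  then show ?thesis
    by (simp add: hopfield_energy_def[abs_def] inner_vec_def activation_def inv_C mult.commute)
qed

lemma grad_energy: "grad (hopfield_energy Hs) q = activation g (matrix_inv (diag C) *v q)"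
  by (rule grad_eqI[OF energy_has_derivative])

text \<open>The energy is a sum of functions of one charge each, so its Hessian is diagonal; the entries
  \<open>g\<^sub>i' (v\<^sub>i) / C\<^sub>i\<close> are positive.\<close>

lemma energy_has_positive_hessian:
  "\<exists>A. has_hessian (hopfield_energy Hs) A q \<and> positive_definite A"
proof -
  obtain d where pos: "\<And>i. d i > 0"
    and d: "\<And>i. (g i has_real_derivative d i) (at (q $ i / C $ i))"
  proof -
    have "\<forall>i. \<exists>d>0. (g i has_real_derivative d) (at (q $ i / C $ i))"
      using g_deriv by blast
    then show thesis using that by metis
  qed
  define a where "a = (\<chi> i. d i / C $ i)"
  have a: "a $ i > 0" for i
    using pos C by (simp add: a_def)
  have "((\<lambda>q. activation g (matrix_inv (diag C) *v q)) has_derivative (\<lambda>h. diag a *v h)) (at q)"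
  proof -
    have "((\<lambda>q. g i (q $ i / C $ i)) has_derivative (\<lambda>h. a $ i * h $ i)) (at q)" for i
    proof -
      have "((\<lambda>q. q $ i) has_derivative (\<lambda>q. q $ i)) (at q)"
        by (rule bounded_linear_imp_has_derivative[OF bounded_linear_vec_nth])
      moreover have "((\<lambda>q. g i (q / C $ i)) has_derivative (*) (a $ i)) (at (q $ i))"
        using charge_activation_deriv[OF d[of i]] by (simp add: has_field_derivative_def a_def)
      ultimately show ?thesis by (rule has_derivative_compose)
    qed
    then show ?thesis
      unfolding activation_def inv_C diag_mult_vector
      by (subst has_derivative_componentwise_within) (auto simp: Basis_vec_def inner_axis)
  qed
  then have "has_hessian (hopfield_energy Hs) (diag a) q"
    unfolding has_hessian_def using energy_has_derivative
    by (auto simp: grad_energy[abs_def] differentiable_def)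
  moreover have "positive_definite (diag a)"
    unfolding positive_definite_def
  proof (intro conjI allI impI)
    show "transpose (diag a) = diag a"
      by (simp add: transpose_def diag_def vec_eq_iff)
    fix h :: "real^'n"
    assume "h \<noteq> 0"
    then obtain i where "h $ i \<noteq> 0" by (auto simp: vec_eq_iff)
    then have "0 < h $ i * (a $ i * h $ i)"
      using a[of i] by (metis mult.left_commute mult_pos_pos not_real_square_gt_zero)
    moreover have "0 \<le> h $ j * (a $ j * h $ j)" for j
      using a[of j] by (metis less_imp_le mult.left_commute mult_nonneg_nonneg zero_le_square)
    ultimately show "h \<bullet> (diag a *v h) > 0"
      unfolding inner_vec_def diag_mult_vector by (auto intro!: sum_pos2[of _ i])
  qed
  ultimately show ?thesis by blast
qed

text \<open>The two power terms \<open>- V \<bullet> I\<close> (from the gradient in \<open>V\<close>) and \<open>I \<bullet> V\<close> (from the gradient in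
  \<open>I\<close>, with the sign of the output) cancel, so only the internal dissipation remains.\<close>

lemma supplied_power_cancels:
  "activation g v \<bullet> grad (\<lambda>V. P V I) (activation g v)
     + I \<bullet> ((-1) *\<^sub>R grad (\<lambda>I'. P (activation g v) I') I)
   = activation g v \<bullet> (matrix_inv (diag R) *v v) - activation g v \<bullet> (T *v activation g v)"
  unfolding grad_potential_effort grad_potential_input hopfield_rhs_def
  by (simp add: inner_diff_right inner_add_right inner_commute)

lemma passivity_iff:
  "passivity_condition (-1) (hopfield_efforts g) P \<longleftrightarrow>
     (\<forall>v V. (\<forall>i. V $ i = g i (v $ i)) \<longrightarrow> V \<bullet> (matrix_inv (diag R) *v v) \<ge> V \<bullet> (T *v V))"
proof -
  have "(\<forall>i. V $ i = g i (v $ i)) \<longleftrightarrow> V = activation g v" for V v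
    by (simp add: activation_def vec_eq_iff)
  then show ?thesis
    unfolding passivity_condition_def efforts_eq ball_simps supplied_power_cancels by simp
qed

lemma relaxation_iff:
  "relaxation_system (-1) (hopfield_efforts g) (hopfield_energy Hs) P
     (hopfield_field C R T g) (hopfield_output C g)
   \<longleftrightarrow> passivity_condition (-1) (hopfield_efforts g) P"
proof -
  have "hopfield_energy Hs differentiable (at q)" for q
    using energy_has_derivative by (auto simp: differentiable_def)
  moreover have "(\<lambda>(V, I). P V I) differentiable (at (V, I))" if "V \<in> hopfield_efforts g" for V I
    using that potential_has_derivative unfolding efforts_eq differentiable_def by blast
  moreover have "grad (hopfield_energy Hs) q \<in> hopfield_efforts g" for q
    by (simp add: grad_energy efforts_eq)
  moreover have "transpose (0 :: real^'n^'n) = 0"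
    by (simp add: transpose_def vec_eq_iff)
  ultimately show ?thesis
    unfolding relaxation_system_def port_hamiltonian_def
    using energy_has_positive_hessian open_efforts
    by (auto simp: grad_energy grad_potential_effort grad_potential_input hopfield_field_def
        hopfield_output_def skew_symmetric_def)
qed

lemma charge_derivative_iff:
  "((\<lambda>s. diag C *v v s) has_vector_derivative w) (at t within S) \<longleftrightarrow>
   (\<exists>v'. (v has_vector_derivative v') (at t within S) \<and> diag C *v v' = w)"
proof
  assume "\<exists>v'. (v has_vector_derivative v') (at t within S) \<and> diag C *v v' = w"
  then show "((\<lambda>s. diag C *v v s) has_vector_derivative w) (at t within S)"
    using bounded_linear.has_vector_derivative[OF matrix_vector_mul_bounded_linear] by blast
next
  assume "((\<lambda>s. diag C *v v s) has_vector_derivative w) (at t within S)"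
  then have "((\<lambda>s. matrix_inv (diag C) *v (diag C *v v s)) has_vector_derivative
      matrix_inv (diag C) *v w) (at t within S)"
    by (rule bounded_linear.has_vector_derivative[OF matrix_vector_mul_bounded_linear])
  then have "(v has_vector_derivative matrix_inv (diag C) *v w) (at t within S)"
    unfolding inv_C_C by simp
  then show "\<exists>v'. (v has_vector_derivative v') (at t within S) \<and> diag C *v v' = w"
    using C_inv_C by blast
qed

lemma solution_iff:
  "hopfield_solution C R T g S v I \<longleftrightarrow>
     (\<forall>t\<in>S. let V = activation g (v t); q = (\<lambda>s. diag C *v v s) in
        (q has_vector_derivative - grad (\<lambda>V'. P V' (I t)) V) (at t within S) \<and>
        V = grad (hopfield_energy Hs) (q t) \<and>
        V = - grad (\<lambda>I'. P V I') (I t))"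
  unfolding hopfield_solution_def Let_def grad_potential_effort grad_potential_input grad_energy
    inv_C_C charge_derivative_iff
  by simp

end

theorem mainTheorem1:
  fixes C R :: "real^'n" and T :: "real^'n^'n" and g Hs :: "'n \<Rightarrow> real \<Rightarrow> real"
  assumes "\<And>i. C $ i > 0" and "\<And>i. R $ i > 0" and "transpose T = T"
    and "\<And>i. sigmoid (g i)"
    and "\<And>i q. (Hs i has_real_derivative g i (q / C $ i)) (at q)"
  shows
    "(\<forall>S v I. is_interval S \<longrightarrow>
        (hopfield_solution C R T g S v I \<longleftrightarrow>
          (\<forall>t\<in>S. let V = activation g (v t); q = (\<lambda>s. diag C *v v s) in
             (q has_vector_derivative
                - grad (\<lambda>V'. hopfield_potential C R T Hs V' (I t)) V) (at t within S) \<and>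
             V = grad (hopfield_energy Hs) (q t) \<and>
             V = - grad (\<lambda>I'. hopfield_potential C R T Hs V I') (I t)))) \<and>
     (relaxation_system (-1) (hopfield_efforts g) (hopfield_energy Hs)
          (hopfield_potential C R T Hs) (hopfield_field C R T g) (hopfield_output C g)
        \<longleftrightarrow> passivity_condition (-1) (hopfield_efforts g) (hopfield_potential C R T Hs)) \<and>
     (passivity_condition (-1) (hopfield_efforts g) (hopfield_potential C R T Hs)
        \<longleftrightarrow> (\<forall>v V. (\<forall>i. V $ i = g i (v $ i)) \<longrightarrow>
               V \<bullet> (matrix_inv (diag R) *v v) \<ge> V \<bullet> (T *v V)))"
proof -
  interpret hopfield_network C R T g Hs
    by unfold_locales (fact assms)+
  show ?thesis
    using solution_iff relaxation_iff passivity_iff by blast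
qed

end
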